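(* For all integers $n\ge 3$, $\operatorname{th}_-(P_n)=\left\lceil \sqrt{2(n+1)}-\frac32\right\rceil$, where $P_n$ is the path on $n$ vertices.
   Context: Skew zero forcing on a finite simple undirected graph $G$: each vertex is blue or white; initially exactly the vertices of a set $S\subseteq V(G)$ are blue. In each round, simultaneously, every vertex (blue or white) that has exactly one white neighbor at the start of the round colors that neighbor blue. If all vertices eventually become blue, $S$ is a skew zero forcing set, and the skew propagation time $\operatorname{pt}_-(G;S)$ is the number of rounds needed until all vertices are blue ($0$ if $S=V(G)$); otherwise $\operatorname{pt}_-(G;S)=\infty$. Define $\operatorname{th}_-(G;S)=|S|+\operatorname{pt}_-(G;S)$ and the skew throttling number $\operatorname{th}_-(G)=\min_{S\subseteq V(G)}\operatorname{th}_-(G;S)$. *)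

theory Defs
  imports Complex_Main "HOL-Library.Extended_Nat" "Graph_Theory.Pair_Digraph"
begin

text \<open>
  A finite simple undirected graph is a \<^locale>\<open>pair_graph\<close>: a finite, loop-free digraph with
  a symmetric arc relation, so each edge is present as both of its arcs. A colouring is
  represented by its set \<open>B\<close> of blue vertices.
\<close>

definition white_neighbors :: "'a pair_pre_digraph \<Rightarrow> 'a set \<Rightarrow> 'a \<Rightarrow> 'a set" where
  "white_neighbors G B v = {w. (v, w) \<in> parcs G \<and> w \<notin> B}"

text \<open>In the skew rule, the forcing vertex \<open>v\<close> may itself be blue or white.\<close>

definition skew_round :: "'a pair_pre_digraph \<Rightarrow> 'a set \<Rightarrow> 'a set" where
  "skew_round G B = B \<union> {w. \<exists>v\<in>pverts G. white_neighbors G B v = {w}}"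

definition blue_after :: "'a pair_pre_digraph \<Rightarrow> 'a set \<Rightarrow> nat \<Rightarrow> 'a set" where
  "blue_after G S t = (skew_round G ^^ t) S"

definition skew_forcing_set :: "'a pair_pre_digraph \<Rightarrow> 'a set \<Rightarrow> bool" where
  "skew_forcing_set G S \<longleftrightarrow> S \<subseteq> pverts G \<and> (\<exists>t. blue_after G S t = pverts G)"

definition skew_propagation_time :: "'a pair_pre_digraph \<Rightarrow> 'a set \<Rightarrow> enat" where
  "skew_propagation_time G S =
    (if skew_forcing_set G S then enat (LEAST t. blue_after G S t = pverts G) else \<infinity>)"

definition skew_throttling_of :: "'a pair_pre_digraph \<Rightarrow> 'a set \<Rightarrow> enat" where
  "skew_throttling_of G S = enat (card S) + skew_propagation_time G S"

definition skew_throttling_number :: "'a pair_pre_digraph \<Rightarrow> enat" where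
  "skew_throttling_number G = Min (skew_throttling_of G ` Pow (pverts G))"

definition path_graph :: "nat \<Rightarrow> nat pair_pre_digraph" where
  "path_graph n = \<lparr>pverts = {1..n},
    parcs = {(i, j). i \<in> {1..n} \<and> j \<in> {1..n} \<and> (j = i + 1 \<or> i = j + 1)}\<rparr>"

lemma pair_graph_path_graph: "pair_graph (path_graph n)"
proof -
  have "parcs (path_graph n) \<subseteq> {1..n} \<times> {1..n}"
    by (auto simp: path_graph_def)
  then have "finite (parcs (path_graph n))"
    by (rule finite_subset) simp
  then show ?thesis
    by unfold_locales (auto simp: path_graph_def symmetric_def intro: symI)
qed

end

theory Submission
  imports Defs
begin

text \<open>
  On a path, \<open>v\<close> forces \<open>v + 1\<close> as soon as \<open>v - 1\<close> is blue or absent, so blue spreads at speed 2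
  within each parity class, and the two absent neighbours \<open>0\<close> and \<open>n + 1\<close> behave as additional
  blue vertices. Within \<open>t\<close> rounds a blue vertex accounts for at most \<open>2 t + 1\<close> vertices and each
  virtual one for at most \<open>t\<close>; hence \<open>k\<close> blue vertices can only succeed if
  \<open>n + 1 \<le> (2 t + 1) (k + 1)\<close>, and AM-GM bounds \<open>k + t\<close> from below. Conversely this inequality
  suffices if \<open>k\<close> and \<open>n\<close> have the same parity. The optimal \<open>(k, t)\<close> may violate this
  parity condition, but then \<open>n + 1\<close> is not the extremal triangular number and there is enough
  slack to shift \<open>k\<close> by one.
\<close>

section \<open>Dynamics of skew forcing on a path\<close>

text \<open>A force onto \<open>w\<close> comes from a vertex \<open>v\<close> adjacent to it, and
  needs the vertex \<open>u\<close> opposite \<open>w\<close> across \<open>v\<close> to be blue or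
  absent. Treating \<open>0\<close> and \<open>n + 1\<close> as blue merges these two cases.\<close>

lemma skew_round_path_graph:
  assumes "B \<subseteq> {1..n}"
  shows "skew_round (path_graph n) B =
    {w \<in> {1..n}. \<exists>u \<in> insert 0 (insert (n + 1) B). w = u \<or> w = u + 2 \<or> u = w + 2}"
    (is "_ = ?R")
proof (intro set_eqI iffI)
  fix w assume "w \<in> skew_round (path_graph n) B"
  then consider "w \<in> B"
    | v where "v \<in> {1..n}" "white_neighbors (path_graph n) B v = {w}"
    by (auto simp: skew_round_def path_graph_def)
  then show "w \<in> ?R"
  proof cases
    case 1
    then show ?thesis using assms by auto
  next
    case 2
    \<comment> \<open>A white neighbor of \<open>v\<close> besides \<open>w\<close> would stop
      \<open>v\<close> from forcing.\<close>
    have W: "x \<in> B" if "x \<in> {1..n}" "x \<noteq> w" "x = v + 1 \<or> v = x + 1" for x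
    proof (rule ccontr)
      assume "x \<notin> B"
      then have "x \<in> white_neighbors (path_graph n) B v"
        using that 2(1) by (auto simp: white_neighbors_def path_graph_def)
      then show False using 2(2) \<open>x \<noteq> w\<close> by simp
    qed
    have "w \<in> white_neighbors (path_graph n) B v" using 2(2) by simp
    then have w: "w \<in> {1..n}" "w = v + 1 \<or> v = w + 1"
      by (auto simp: white_neighbors_def path_graph_def)
    from w(2) show ?thesis
    proof
      assume wv: "w = v + 1"
      obtain x where x: "v = x + 1" using 2(1) by (cases v) auto
      then have "x \<in> insert 0 B" using W[of x] 2(1) wv by (cases "x = 0") auto
      then show ?thesis using w(1) wv x by auto
    next
      assume vw: "v = w + 1"
      then have "v + 1 \<in> insert (n + 1) B" using W[of "v + 1"] 2(1) by (cases "v = n") auto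
      then show ?thesis using w(1) vw by auto
    qed
  qed
next
  fix w assume "w \<in> ?R"
  then obtain u where w: "w \<in> {1..n}" and u: "u \<in> insert 0 (insert (n + 1) B)"
    and wu: "w = u \<or> w = u + 2 \<or> u = w + 2" by blast
  show "w \<in> skew_round (path_graph n) B"
  proof (cases "w \<in> B")
    case True
    then show ?thesis by (simp add: skew_round_def)
  next
    case False
    \<comment> \<open>The forcing vertex is the midpoint of \<open>u\<close> and
      \<open>w\<close>.\<close>
    define v where "v = (if w = u + 2 then u + 1 else w + 1)"
    have "v \<in> {1..n}" using w u wu False assms by (auto simp: v_def)
    moreover have "white_neighbors (path_graph n) B v = {w}"
      using w u wu False assms by (auto simp: v_def white_neighbors_def path_graph_def)
    ultimately show ?thesis by (auto simp: skew_round_def path_graph_def)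
  qed
qed

text \<open>Iterating the round gives balls of radius \<open>t\<close> for steps of length 2. Range
  limits never block a walk: every point between a source and its target lies in
  \<open>{0..n + 1}\<close>, so it is a path vertex or virtual.\<close>

lemma blue_after_path_graph:
  assumes "S \<subseteq> {1..n}"
  shows "blue_after (path_graph n) S t =
    {w \<in> {1..n}. \<exists>s \<in> insert 0 (insert (n + 1) S). \<exists>j\<le>t. w = s + 2 * j \<or> s = w + 2 * j}"
proof (induction t)
  case 0
  then show ?case using assms by (auto simp: blue_after_def)
next
  case (Suc t)
  let ?S = "insert 0 (insert (n + 1) S)"
  let ?B = "\<lambda>t. {w \<in> {1..n}. \<exists>s \<in> ?S. \<exists>j\<le>t. w = s + 2 * j \<or> s = w + 2 * j}"
  have "blue_after (path_graph n) S (Suc t) = skew_round (path_graph n) (?B t)"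
    using Suc by (simp add: blue_after_def)
  also have "\<dots> = {w \<in> {1..n}. \<exists>u \<in> insert 0 (insert (n + 1) (?B t)).
      w = u \<or> w = u + 2 \<or> u = w + 2}"
    by (rule skew_round_path_graph) auto
  also have "\<dots> = ?B (Suc t)"
  proof (intro set_eqI iffI)
    fix w assume "w \<in> {w \<in> {1..n}. \<exists>u \<in> insert 0 (insert (n + 1) (?B t)).
      w = u \<or> w = u + 2 \<or> u = w + 2}"
    then obtain u where w: "w \<in> {1..n}" and u: "u \<in> insert 0 (insert (n + 1) (?B t))"
      and wu: "w = u \<or> w = u + 2 \<or> u = w + 2" by blast
    from u obtain s j where s: "s \<in> ?S" "j \<le> t" "u = s + 2 * j \<or> s = u + 2 * j"
      by fastforce
    have "\<exists>i\<in>{j, j - 1, j + 1}. w = s + 2 * i \<or> s = w + 2 * i"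
      using s(3) wu by (cases j) auto
    then obtain i where i: "i \<in> {j, j - 1, j + 1}" "w = s + 2 * i \<or> s = w + 2 * i"
      by blast
    from i(1) have "i \<le> Suc t" using s(2) by auto
    then show "w \<in> ?B (Suc t)" using w s(1) i(2) by blast
  next
    fix w assume "w \<in> ?B (Suc t)"
    then obtain s j where w: "w \<in> {1..n}" and s: "s \<in> ?S" and j: "j \<le> Suc t"
      and sw: "w = s + 2 * j \<or> s = w + 2 * j" by blast
    \<comment> \<open>One step back from \<open>w\<close> towards \<open>s\<close>; this point may
      be virtual.\<close>
    define u where "u = (if j = 0 then w else if w = s + 2 * j then w - 2 else w + 2)"
    have le: "s \<le> n + 1" using s assms by auto
    have us: "u = s + 2 * (j - 1) \<or> s = u + 2 * (j - 1)"
      using sw by (auto simp: u_def)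
    have "u \<le> n + 1" using w sw le by (auto simp: u_def)
    then have "u \<in> {0, n + 1} \<or> u \<in> {1..n}" by auto
    moreover have "j - 1 \<le> t" using j by simp
    ultimately have "u \<in> insert 0 (insert (n + 1) (?B t))" using s us by blast
    moreover have "w = u \<or> w = u + 2 \<or> u = w + 2" using sw by (auto simp: u_def)
    ultimately show "w \<in> {w \<in> {1..n}. \<exists>u \<in> insert 0 (insert (n + 1) (?B t)).
      w = u \<or> w = u + 2 \<or> u = w + 2}" using w by blast
  qed
  finally show ?case .
qed

section \<open>Counting bound for forcing sets\<close>

lemma path_graph_covering_bound:
  assumes S: "S \<subseteq> {1..n}" and all: "blue_after (path_graph n) S t = {1..n}"
  shows "n + 1 \<le> (2 * t + 1) * (card S + 1)"
proof -
  \<comment> \<open>The value \<open>j = 0\<close> is counted only once. Truncated subtraction may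
    add a spurious \<open>0\<close>, which is harmless for an upper bound.\<close>
  let ?N = "\<lambda>s. (\<lambda>j. s + 2 * j) ` {..t} \<union> (\<lambda>j. s - 2 * j) ` {1..t}"
  have fin: "finite S" using S finite_subset by blast
  have N: "card (?N s) \<le> 2 * t + 1" for s :: nat
  proof -
    have "card (?N s) \<le> card ((\<lambda>j. s + 2 * j) ` {..t}) + card ((\<lambda>j. s - 2 * j) ` {1..t})"
      by (rule card_Un_le)
    also have "\<dots> \<le> card {..t} + card {1..t}"
      by (intro add_mono card_image_le) auto
    finally show ?thesis by simp
  qed
  \<comment> \<open>The virtual sources lie outside \<open>{1..n}\<close>, so their distances start
    at 1: they contribute \<open>t\<close> each, not \<open>2 * t + 1\<close>.\<close>
  have sub: "{1..n} \<subseteq> (\<Union>s\<in>S. ?N s) \<union> ((\<lambda>j. 2 * j) ` {1..t} \<union> (\<lambda>j. n + 1 - 2 * j) ` {1..t})"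
  proof
    fix w assume w: "w \<in> {1..n}"
    then obtain s j where s: "s \<in> insert 0 (insert (n + 1) S)" and j: "j \<le> t"
      and sw: "w = s + 2 * j \<or> s = w + 2 * j"
      using all blue_after_path_graph[OF S, of t] by blast
    consider "s \<in> S" | "s = 0" | "s = n + 1" using s by blast
    then show "w \<in> (\<Union>s\<in>S. ?N s) \<union> ((\<lambda>j. 2 * j) ` {1..t} \<union> (\<lambda>j. n + 1 - 2 * j) ` {1..t})"
    proof cases
      case 1
      have "w \<in> ?N s"
      proof (cases "w = s + 2 * j")
        case False
        then have "w = s - 2 * j" "j \<in> {1..t}" using sw j by (cases "j = 0"; auto)+
        then show ?thesis by blast
      qed (use j in blast)
      then show ?thesis using 1 by blast
    next
      case 2
      then have "w = 2 * j" "j \<in> {1..t}" using sw j w by auto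
      then show ?thesis by blast
    next
      case 3
      then have "w = n + 1 - 2 * j" "j \<in> {1..t}" using sw j w by (cases "j = 0"; auto)+
      then show ?thesis by blast
    qed
  qed
  have "card {1..n} \<le> card ((\<Union>s\<in>S. ?N s) \<union>
      ((\<lambda>j. 2 * j) ` {1..t} \<union> (\<lambda>j. n + 1 - 2 * j) ` {1..t}))"
    by (rule card_mono[OF _ sub]) (use fin in auto)
  also have "\<dots> \<le> card (\<Union>s\<in>S. ?N s) +
      (card ((\<lambda>j. 2 * j) ` {1..t}) + card ((\<lambda>j. n + 1 - 2 * j) ` {1..t}))"
    by (meson add_left_mono card_Un_le order_trans)
  also have "\<dots> \<le> (\<Sum>s\<in>S. card (?N s)) + (card {1..t} + card {1..t})"
    by (intro add_mono card_image_le card_UN_le fin) auto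
  also have "\<dots> \<le> (2 * t + 1) * card S + 2 * t"
    using sum_bounded_above[of S "\<lambda>s. card (?N s)" "2 * t + 1"] N by (simp add: mult.commute)
  finally show ?thesis by simp
qed

section \<open>Construction of forcing sets\<close>

text \<open>Cut the progression into blocks of \<open>2 * t + 1\<close> consecutive terms and take
  the middle term of each.\<close>

lemma arith_progression_cover:
  fixes a L r t :: nat
  assumes "L \<le> r * (2 * t + 1)"
  shows "\<exists>C \<subseteq> (\<lambda>j. a + 2 * j) ` {..<L}. card C \<le> r \<and>
    (\<forall>j<L. \<exists>c\<in>C. \<exists>d\<le>t. a + 2 * j = c + 2 * d \<or> c = a + 2 * j + 2 * d)"
proof (cases "L = 0")
  case False
  let ?q = "2 * t + 1"
  \<comment> \<open>The minimum keeps the center of an incomplete last block inside the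
    progression.\<close>
  let ?f = "\<lambda>i. a + 2 * min (i * ?q + t) (L - 1)"
  have "?f ` {..<r} \<subseteq> (\<lambda>j. a + 2 * j) ` {..<L}"
    using False by (auto intro!: imageI)
  moreover have "card (?f ` {..<r}) \<le> r"
    using card_image_le[of "{..<r}" ?f] by simp
  moreover have "\<exists>c\<in>?f ` {..<r}. \<exists>d\<le>t. a + 2 * j = c + 2 * d \<or> c = a + 2 * j + 2 * d"
    if "j < L" for j
  proof -
    define i where "i = j div ?q"
    define m where "m = min (i * ?q + t) (L - 1)"
    have "i < r" using that assms by (simp add: i_def less_mult_imp_div_less)
    have "j = i * ?q + j mod ?q" unfolding i_def by (rule div_mult_mod_eq[symmetric])
    moreover have "j mod ?q < ?q" by simp
    ultimately have "i * ?q \<le> j" "j \<le> i * ?q + 2 * t" by linarith+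
    then have "j \<le> m + t" "m \<le> j + t" using that unfolding m_def by linarith+
    then have "\<exists>d\<le>t. a + 2 * j = (a + 2 * m) + 2 * d \<or> a + 2 * m = a + 2 * j + 2 * d"
      by (intro exI[of _ "if m \<le> j then j - m else m - j"]) auto
    then show ?thesis using \<open>i < r\<close> unfolding m_def by blast
  qed
  ultimately show ?thesis by blast
qed auto

text \<open>The two parity classes are covered separately, by \<open>k div 2\<close> and
  \<open>k - k div 2\<close> blue vertices. Equal parity of \<open>n\<close> and \<open>k\<close>
  makes the inequality split into one bound per class without rounding loss.\<close>

lemma path_graph_forcing_set_exists:
  assumes le: "n + 1 \<le> (2 * t + 1) * (k + 1)" and parity: "even n \<longleftrightarrow> even k"
  shows "\<exists>S \<subseteq> {1..n}. card S \<le> k \<and> blue_after (path_graph n) S t = {1..n}"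
proof -
  \<comment> \<open>\<open>L\<close> and \<open>M\<close> count the even and odd positions left to
    cover. Source \<open>0\<close> reaches the even positions below \<open>a\<close>. Source
    \<open>n + 1\<close> serves the odd class if \<open>n\<close> is even, and the even class
    otherwise, whence \<open>2 * t + 1\<close> there.\<close>
  define a L M where "a = 2 * t + 2"
    and "L = (if even n then n div 2 - t else (n + 1) div 2 - (2 * t + 1))"
    and "M = (if even n then n div 2 - t else (n + 1) div 2)"
  have LM: "L \<le> (k div 2) * (2 * t + 1) \<and> M \<le> (k - k div 2) * (2 * t + 1)"
  proof (cases "even n")
    case True
    then obtain m h where "n = 2 * m" "k = 2 * h" using parity by (auto elim!: evenE)
    then show ?thesis using le by (auto simp: L_def M_def algebra_simps)
  next
    case False
    then obtain m h where "n = 2 * m + 1" "k = 2 * h + 1" using parity by (auto elim!: oddE)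
    then show ?thesis using le by (auto simp: L_def M_def algebra_simps)
  qed
  obtain C where C: "C \<subseteq> (\<lambda>j. a + 2 * j) ` {..<L}" "card C \<le> k div 2"
    "\<forall>j<L. \<exists>c\<in>C. \<exists>d\<le>t. a + 2 * j = c + 2 * d \<or> c = a + 2 * j + 2 * d"
    using arith_progression_cover[OF LM[THEN conjunct1]] by blast
  obtain D where D: "D \<subseteq> (\<lambda>j. 1 + 2 * j) ` {..<M}" "card D \<le> k - k div 2"
    "\<forall>j<M. \<exists>c\<in>D. \<exists>d\<le>t. 1 + 2 * j = c + 2 * d \<or> c = 1 + 2 * j + 2 * d"
    using arith_progression_cover[OF LM[THEN conjunct2]] by blast
  have sub: "C \<union> D \<subseteq> {1..n}"
  proof -
    have "a + 2 * j \<in> {1..n}" if "j < L" for j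
      using that by (auto simp: a_def L_def split: if_splits)
    moreover have "1 + 2 * j \<in> {1..n}" if "j < M" for j
      using that by (auto simp: M_def elim!: oddE split: if_splits)
    ultimately show ?thesis using C(1) D(1) by blast
  qed
  have "card (C \<union> D) \<le> k"
    using card_Un_le[of C D] C(2) D(2) by simp
  moreover have "blue_after (path_graph n) (C \<union> D) t = {1..n}"
  proof -
    have "\<exists>s \<in> insert 0 (insert (n + 1) (C \<union> D)). \<exists>j\<le>t. w = s + 2 * j \<or> s = w + 2 * j"
      if w: "w \<in> {1..n}" for w
    proof -
      consider j where "j < L" "w = a + 2 * j" | j where "j < M" "w = 1 + 2 * j"
        | j where "j \<le> t" "w = 2 * j" | j where "j \<le> t" "n + 1 = w + 2 * j"
      proof -
        have "(\<exists>j<L. w = a + 2 * j) \<or> (\<exists>j<M. w = 1 + 2 * j) \<or> (\<exists>j\<le>t. w = 2 * j)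
          \<or> (\<exists>j\<le>t. n + 1 = w + 2 * j)"
        proof (cases "even w")
          case True
          then obtain i where i: "w = 2 * i" by (auto elim: evenE)
          consider "i \<le> t" | "t < i" "i - (t + 1) < L" | "i > t" "L \<le> i - (t + 1)" by linarith
          then show ?thesis
          proof cases
            case 2
            then have "w = a + 2 * (i - (t + 1))" by (simp add: i a_def)
            then show ?thesis using 2 by blast
          next
            case 3
            \<comment> \<open>For even \<open>n\<close> the even progression runs up to
              \<open>n\<close>, leaving nothing to cover from the right.\<close>
            have "odd n"
              using 3 i w by (auto simp: L_def elim!: evenE)
            then obtain m where m: "n = 2 * m + 1" by (auto elim: oddE)
            have "m + 1 - i \<le> t" "n + 1 = w + 2 * (m + 1 - i)"
              using 3 i w m by (auto simp: L_def)
            then show ?thesis by blast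
          qed (use i in blast)
        next
          case False
          then obtain i where i: "w = 1 + 2 * i" by (auto elim: oddE)
          show ?thesis
          proof (cases "i < M")
            case False
            have "even n"
            proof (rule ccontr)
              assume "odd n"
              then show False using False i w by (auto simp: M_def elim!: oddE)
            qed
            then obtain m where m: "n = 2 * m" by (auto elim: evenE)
            have "m - i \<le> t" "n + 1 = w + 2 * (m - i)"
              using False i w m by (auto simp: M_def)
            then show ?thesis by blast
          qed (use i in blast)
        qed
        then show thesis using that by blast
      qed
      then show ?thesis
      proof cases
        case 1
        then obtain c d where "c \<in> C" "d \<le> t" "w = c + 2 * d \<or> c = w + 2 * d" using C(3) by metis
        then show ?thesis by blast
      next
        case 2
        then obtain c d where "c \<in> D" "d \<le> t" "w = c + 2 * d \<or> c = w + 2 * d" using D(3) by metis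
        then show ?thesis by blast
      qed auto
    qed
    then show ?thesis using blue_after_path_graph[OF sub, of t] by blast
  qed
  ultimately show ?thesis using sub by blast
qed

section \<open>Optimizing the parameters\<close>

lemma throttling_parameters_exist:
  fixes n T :: nat
  assumes "n \<ge> 1" and T: "2 * (n + 1) \<le> (T + 1) * (T + 2)"
  shows "\<exists>k t. k + t = T \<and> n + 1 \<le> (2 * t + 1) * (k + 1) \<and> (even n \<longleftrightarrow> even k)"
proof (cases "even T")
  case True
  then obtain h where h: "T = 2 * h" by (auto elim: evenE)
  have le: "n \<le> 2 * (h * h) + 3 * h" using T by (simp add: h algebra_simps)
  then have "h \<ge> 1" using assms(1) by (cases h) auto
  show ?thesis
  proof (cases "even n \<longleftrightarrow> even h")
    case True
    then show ?thesis using le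
      by (intro exI[of _ h]) (auto simp: h algebra_simps)
  next
    case False
    \<comment> \<open>The extremal \<open>n\<close>, attained by \<open>k = t = h\<close>, has the
      parity of \<open>h\<close>. Moving to \<open>k = h - 1\<close>, \<open>t = h + 1\<close>
      lowers the product by exactly one.\<close>
    then have "n \<noteq> 2 * (h * h) + 3 * h" by auto
    with le have "n + 1 \<le> 2 * (h * h) + 3 * h" by simp
    moreover obtain g where "h = Suc g" using \<open>h \<ge> 1\<close> by (cases h) auto
    ultimately show ?thesis using False
      by (intro exI[of _ g] exI[of _ "g + 2"]) (auto simp: h algebra_simps)
  qed
next
  case False
  then obtain h where h: "T = 2 * h + 1" by (auto elim: oddE)
  have le: "n \<le> 2 * (h * h) + 5 * h + 2" using T by (simp add: h algebra_simps)
  show ?thesis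
  proof (cases "even n \<longleftrightarrow> even h")
    case True
    then show ?thesis using le
      by (intro exI[of _ h] exI[of _ "h + 1"]) (auto simp: h algebra_simps)
  next
    case False
    \<comment> \<open>Again the extremal value has the parity of \<open>h\<close>; exchanging
      \<open>h\<close> and \<open>h + 1\<close> costs exactly one.\<close>
    then have "n \<noteq> 2 * (h * h) + 5 * h + 2" by auto
    with le have "n + 1 \<le> 2 * (h * h) + 5 * h + 2" by simp
    then show ?thesis using False
      by (intro exI[of _ "h + 1"] exI[of _ h]) (auto simp: h algebra_simps)
  qed
qed

lemma throttling_formula_le:
  fixes n k t :: nat
  assumes "n + 1 \<le> (2 * t + 1) * (k + 1)"
  shows "nat \<lceil>sqrt (2 * (real n + 1)) - 3 / 2\<rceil> \<le> k + t"
proof -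
  have "real (n + 1) \<le> real ((2 * t + 1) * (k + 1))" using assms by (simp only: of_nat_le_iff)
  then have "2 * (real n + 1) \<le> (2 * real t + 1) * (2 * real k + 2)"
    by (simp add: algebra_simps)
  \<comment> \<open>AM-GM for the factors \<open>2 t + 1\<close> and \<open>2 k + 2\<close>: their
    mean is \<open>k + t + 3/2\<close>, and the square used is that of their difference.\<close>
  also have "\<dots> \<le> (real k + real t + 3 / 2)\<^sup>2"
    using zero_le_power2[of "2 * real t - 2 * real k - 1"]
    by (simp add: power2_eq_square algebra_simps)
  finally have "sqrt (2 * (real n + 1)) \<le> real k + real t + 3 / 2"
    by (simp add: real_le_lsqrt)
  then show ?thesis by (simp add: ceiling_le_iff nat_le_iff)
qed

lemma throttling_formula_triangular:
  fixes n :: nat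
  defines "T \<equiv> nat \<lceil>sqrt (2 * (real n + 1)) - 3 / 2\<rceil>"
  shows "2 * (n + 1) \<le> (T + 1) * (T + 2)"
proof -
  have "sqrt (2 * (real n + 1)) \<le> real T + 3 / 2"
    unfolding T_def by linarith
  then have "2 * (real n + 1) \<le> (real T + 3 / 2)\<^sup>2"
    using sqrt_le_D by blast
  \<comment> \<open>Since \<open>(T + 3/2)^2 = (T + 1) (T + 2) + 1/4\<close>, clearing denominators
    leaves an excess of 1, which integrality removes.\<close>
  then have "real (8 * (n + 1)) \<le> real (4 * ((T + 1) * (T + 2)) + 1)"
    by (simp add: power2_eq_square algebra_simps)
  then have "8 * (n + 1) \<le> 4 * ((T + 1) * (T + 2)) + 1"
    by (simp only: of_nat_le_iff)
  then show ?thesis by linarith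
qed

theorem proposition3p2:
  fixes n :: nat
  assumes "n \<ge> 3"
  shows "skew_throttling_number (path_graph n) = enat (nat \<lceil>sqrt (2 * (real n + 1)) - 3 / 2\<rceil>)"
proof -
  let ?G = "path_graph n"
  define T where "T = nat \<lceil>sqrt (2 * (real n + 1)) - 3 / 2\<rceil>"
  have V: "pverts ?G = {1..n}" by (simp add: path_graph_def)
  have lower: "enat T \<le> skew_throttling_of ?G S" if S: "S \<subseteq> {1..n}" for S
  proof (cases "skew_forcing_set ?G S")
    case True
    define t where "t = (LEAST t. blue_after ?G S t = {1..n})"
    have "blue_after ?G S t = {1..n}"
      using True unfolding t_def skew_forcing_set_def V by (metis (mono_tags, lifting) LeastI)
    then have "T \<le> card S + t"
      unfolding T_def by (intro throttling_formula_le path_graph_covering_bound S)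
    then show ?thesis
      using True by (simp add: skew_throttling_of_def skew_propagation_time_def V t_def)
  qed (simp add: skew_throttling_of_def skew_propagation_time_def)
  have "2 * (n + 1) \<le> (T + 1) * (T + 2)"
    unfolding T_def by (rule throttling_formula_triangular)
  then obtain k t where kt: "k + t = T" "n + 1 \<le> (2 * t + 1) * (k + 1)" "even n \<longleftrightarrow> even k"
    using throttling_parameters_exist[of n T] assms by auto
  obtain S where S: "S \<subseteq> {1..n}" "card S \<le> k" "blue_after ?G S t = {1..n}"
    using path_graph_forcing_set_exists[OF kt(2,3)] by blast
  have "skew_forcing_set ?G S" using S by (auto simp: skew_forcing_set_def V)
  moreover have "(LEAST t. blue_after ?G S t = {1..n}) \<le> t" using S(3) by (rule Least_le)
  \<comment> \<open>\<open>card S \<le> k\<close> and propagation within \<open>t\<close> rounds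
    suffice, because the lower bound forces equality.\<close>
  ultimately have "skew_throttling_of ?G S \<le> enat T"
    using S(2) kt(1) by (simp add: skew_throttling_of_def skew_propagation_time_def V)
  with lower[OF S(1)] have "enat T = skew_throttling_of ?G S" by (rule antisym)
  then show ?thesis
    unfolding skew_throttling_number_def V T_def[symmetric]
    using lower S(1) by (intro Min_eqI) auto
qed

end
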